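(* Let $\mathbf{M}=(M;\leq,0,1)$ be a non-trivial complete lattice, let $S$ be a non-empty set and $R\subseteq S\times S$, and let $\mathbf{A}$ and $\mathbf{B}$ be bounded subposets of $\mathbf{M}^{S}$. Let $P_R\colon A\to M^S$ and $T_R\colon B\to M^S$ be the lower and upper transition operators constructed by means of $(S,R)$. Then for all $a\in A$ and all $b\in B$: $P_R(a)\leq b$ if and only if $a\leq T_R(b)$. Moreover: (a) Suppose that for every $t\in S$ there is an element $b^t\in B$ such that for every $s\in S$ with $(s,t)\notin R$ we have $\bigwedge_M\{u(b^t)\mid sRu\}\not\leq t(b^t)$ and $t(b^t)\neq 1$. Then $R=R_{T_R}$. (b) Suppose that for every $s\in S$ there is an element $a^s\in A$ such that for every $t\in S$ with $(s,t)\notin R$ we have $\bigvee_M\{u(a^s)\mid uRt\}\not\geq s(a^s)$ and $s(a^s)\neq 0$. Then $R=R^{P_R}$. (c) If $R=R_{T_R}$ and $T_R(B)\subseteq A$, then $R=R_{T_R}=R^{P_R}$. (d) If $R=R^{P_R}$ and $P_R(A)\subseteq B$, then $R=R_{T_R}=R^{P_R}$.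
   Context: Non-trivial means $0\neq 1$. $\mathbf{M}^S$ is ordered componentwise; a bounded subposet of $\mathbf{M}^S$ is a subset containing the constant tuples $0$ and $1$ with the inherited order. For $s\in S$ and $m\in M^S$, $s(m)$ denotes the $s$-th component of $m$; $sRt$ means $(s,t)\in R$. The upper transition operator $T_R\colon B\to M^S$ is $T_R(b)(s)=\bigwedge_M\{t(b)\mid sRt\}$ and the lower transition operator $P_R\colon A\to M^S$ is $P_R(a)(t)=\bigvee_M\{s(a)\mid sRt\}$ (empty meet $=1$, empty join $=0$). For $T\colon B\to M^S$, $R_T=\{(s,t)\in S\times S\mid \forall b\in B:\ s(T(b))\leq t(b)\}$; for $P\colon A\to M^S$, $R^{P}=\{(s,t)\in S\times S\mid \forall a\in A:\ s(a)\leq t(P(a))\}$. *)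

theory Defs
  imports Main
begin

text \<open>
  The complete lattice \<open>M\<close> is a type of class \<open>complete_lattice\<close> with \<open>0 = bot\<close> and \<open>1 = top\<close>;
  the non-empty set \<open>S\<close> is a type \<open>'s\<close>. Hence \<open>M^S\<close> is the type \<open>'s \<Rightarrow> 'm\<close> with the library's
  pointwise order, and the component \<open>s(m)\<close> is the application \<open>m s\<close>. A bounded subposet is
  given by its carrier, whose order is the inherited one.
\<close>

definition bounded_subposet :: "('s \<Rightarrow> 'm::complete_lattice) set \<Rightarrow> bool" where
  "bounded_subposet A \<longleftrightarrow> (\<lambda>_. bot) \<in> A \<and> (\<lambda>_. top) \<in> A"

text \<open>
  The formulas for the transition operators do not depend on their domains, so the operators are
  total functions on \<open>M^S\<close>. Domains are passed explicitly wherever they matter, namely in the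
  relations induced by an operator.
\<close>

definition upper_transition :: "('s \<times> 's) set \<Rightarrow> ('s \<Rightarrow> 'm::complete_lattice) \<Rightarrow> 's \<Rightarrow> 'm" where
  "upper_transition R b = (\<lambda>s. Inf {b t | t. (s, t) \<in> R})"

definition lower_transition :: "('s \<times> 's) set \<Rightarrow> ('s \<Rightarrow> 'm::complete_lattice) \<Rightarrow> 's \<Rightarrow> 'm" where
  "lower_transition R a = (\<lambda>t. Sup {a s | s. (s, t) \<in> R})"

definition upper_rel ::
  "('s \<Rightarrow> 'm::complete_lattice) set \<Rightarrow> (('s \<Rightarrow> 'm) \<Rightarrow> 's \<Rightarrow> 'm) \<Rightarrow> ('s \<times> 's) set" where
  "upper_rel B T = {(s, t). \<forall>b\<in>B. T b s \<le> b t}"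

definition lower_rel ::
  "('s \<Rightarrow> 'm::complete_lattice) set \<Rightarrow> (('s \<Rightarrow> 'm) \<Rightarrow> 's \<Rightarrow> 'm) \<Rightarrow> ('s \<times> 's) set" where
  "lower_rel A P = {(s, t). \<forall>a\<in>A. a s \<le> P a t}"

end

theory Submission
  imports Defs
begin

text \<open>
  The operators form a Galois connection on \<open>M^S\<close>, so a pair in the relation induced by one of
  them can be transferred to the other by the counit \<open>P (T b) \<le> b\<close> or the unit \<open>a \<le> T (P a)\<close>.
\<close>

text \<open>A join lies below \<open>b t\<close> iff each of its members does, and dually for a
  meet, so both sides reduce to the same condition: \<open>a s \<le> b t\<close> for all
  \<open>(s, t) \<in> R\<close>.\<close>

lemma lower_upper_galois:
  "lower_transition R a \<le> b \<longleftrightarrow> a \<le> upper_transition R b"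
  unfolding lower_transition_def upper_transition_def le_fun_def le_Inf_iff Sup_le_iff by blast

lemma lower_upper_le: "lower_transition R (upper_transition R b) t \<le> b t"
  using lower_upper_galois[of R "upper_transition R b" b] by (simp add: le_fun_def)

lemma le_upper_lower: "a s \<le> upper_transition R (lower_transition R a) s"
  using lower_upper_galois[of R a "lower_transition R a"] by (simp add: le_fun_def)

text \<open>For \<open>(s, t) \<in> R\<close> the value \<open>b t\<close> is among those whose meet
  is formed at \<open>s\<close>. This holds for any \<open>B\<close>, so recovering \<open>R\<close>
  is only a matter of the reverse inclusion.\<close>

lemma subset_upper_rel: "R \<subseteq> upper_rel B (upper_transition R)"
  unfolding upper_rel_def upper_transition_def by (auto intro!: Inf_lower)

lemma subset_lower_rel: "R \<subseteq> lower_rel A (lower_transition R)"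
  unfolding lower_rel_def lower_transition_def by (auto intro!: Sup_upper)

text \<open>It is enough to separate each pair outside \<open>R\<close> by some test element, which
  may depend on both \<open>s\<close> and \<open>t\<close>; the opposite inclusion is
  \<open>subset_upper_rel\<close>.\<close>

lemma upper_rel_eqI:
  assumes "\<And>s t. (s, t) \<notin> R \<Longrightarrow> \<exists>b\<in>B. \<not> upper_transition R b s \<le> b t"
  shows "R = upper_rel B (upper_transition R)"
  using subset_upper_rel[of R B] assms unfolding upper_rel_def by blast

lemma lower_rel_eqI:
  assumes "\<And>s t. (s, t) \<notin> R \<Longrightarrow> \<exists>a\<in>A. \<not> a s \<le> lower_transition R a t"
  shows "R = lower_rel A (lower_transition R)"
  using subset_lower_rel[of R A] assms unfolding lower_rel_def by blast

text \<open>For \<open>b \<in> B\<close> the image \<open>T b\<close> lies in \<open>A\<close> and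
  serves as test element: \<open>T b s \<le> P (T b) t \<le> b t\<close>, the last step being the
  counit.\<close>

lemma lower_rel_subset_upper_rel:
  assumes "upper_transition R ` B \<subseteq> A"
  shows "lower_rel A (lower_transition R) \<subseteq> upper_rel B (upper_transition R)"
  using assms lower_upper_le[of R] order_trans
  unfolding lower_rel_def upper_rel_def image_subset_iff by clarsimp blast

text \<open>Dually, \<open>P a\<close> lies in \<open>B\<close> and is tested:
  \<open>a s \<le> T (P a) s \<le> P a t\<close>, the first step being the unit.\<close>

lemma upper_rel_subset_lower_rel:
  assumes "lower_transition R ` A \<subseteq> B"
  shows "upper_rel B (upper_transition R) \<subseteq> lower_rel A (lower_transition R)"
  using assms le_upper_lower[of _ _ R] order_trans
  unfolding lower_rel_def upper_rel_def image_subset_iff by clarsimp blast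

theorem theorem2p6:
  fixes R :: "('s \<times> 's) set"
    and A B :: "('s \<Rightarrow> 'm::complete_lattice) set"
  assumes nontrivial: "(bot :: 'm) \<noteq> top"
    and A: "bounded_subposet A"
    and B: "bounded_subposet B"
  shows
    "(\<forall>a\<in>A. \<forall>b\<in>B. lower_transition R a \<le> b \<longleftrightarrow> a \<le> upper_transition R b)
     \<and> ((\<forall>t. \<exists>bt\<in>B. \<forall>s. (s, t) \<notin> R \<longrightarrow> \<not> Inf {bt u | u. (s, u) \<in> R} \<le> bt t \<and> bt t \<noteq> top)
          \<longrightarrow> R = upper_rel B (upper_transition R))
     \<and> ((\<forall>s. \<exists>as\<in>A. \<forall>t. (s, t) \<notin> R \<longrightarrow> \<not> Sup {as u | u. (u, t) \<in> R} \<ge> as s \<and> as s \<noteq> bot)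
          \<longrightarrow> R = lower_rel A (lower_transition R))
     \<and> (R = upper_rel B (upper_transition R) \<and> upper_transition R ` B \<subseteq> A
          \<longrightarrow> R = upper_rel B (upper_transition R)
            \<and> upper_rel B (upper_transition R) = lower_rel A (lower_transition R))
     \<and> (R = lower_rel A (lower_transition R) \<and> lower_transition R ` A \<subseteq> B
          \<longrightarrow> R = upper_rel B (upper_transition R)
            \<and> upper_rel B (upper_transition R) = lower_rel A (lower_transition R))"
proof (intro conjI)
  show "\<forall>a\<in>A. \<forall>b\<in>B. lower_transition R a \<le> b \<longleftrightarrow> a \<le> upper_transition R b"
    by (simp add: lower_upper_galois)
next
  show "(\<forall>t. \<exists>bt\<in>B. \<forall>s. (s, t) \<notin> R \<longrightarrow> \<not> Inf {bt u | u. (s, u) \<in> R} \<le> bt t \<and> bt t \<noteq> top)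
      \<longrightarrow> R = upper_rel B (upper_transition R)"
  proof (intro impI upper_rel_eqI)
    fix s t
    assume "\<forall>t. \<exists>bt\<in>B. \<forall>s. (s, t) \<notin> R \<longrightarrow> \<not> Inf {bt u | u. (s, u) \<in> R} \<le> bt t \<and> bt t \<noteq> top"
      and "(s, t) \<notin> R"
    \<comment> \<open>The witness is the element attached to \<open>t\<close>, the same for every
      \<open>s\<close>.\<close>
    then show "\<exists>b\<in>B. \<not> upper_transition R b s \<le> b t"
      unfolding upper_transition_def by blast
  qed
next
  show "(\<forall>s. \<exists>as\<in>A. \<forall>t. (s, t) \<notin> R \<longrightarrow> \<not> Sup {as u | u. (u, t) \<in> R} \<ge> as s \<and> as s \<noteq> bot)
      \<longrightarrow> R = lower_rel A (lower_transition R)"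
  proof (intro impI lower_rel_eqI)
    fix s t
    assume "\<forall>s. \<exists>as\<in>A. \<forall>t. (s, t) \<notin> R \<longrightarrow> \<not> Sup {as u | u. (u, t) \<in> R} \<ge> as s \<and> as s \<noteq> bot"
      and "(s, t) \<notin> R"
    \<comment> \<open>Here the witness is the element attached to \<open>s\<close>, the same for
      every \<open>t\<close>.\<close>
    then show "\<exists>a\<in>A. \<not> a s \<le> lower_transition R a t"
      unfolding lower_transition_def by blast
  qed
next
  show "R = upper_rel B (upper_transition R) \<and> upper_transition R ` B \<subseteq> A
      \<longrightarrow> R = upper_rel B (upper_transition R)
        \<and> upper_rel B (upper_transition R) = lower_rel A (lower_transition R)"
    \<comment> \<open>The lower relation is squeezed: it contains \<open>R\<close> and lies in the
      upper relation, which equals \<open>R\<close> by assumption.\<close>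
    using lower_rel_subset_upper_rel[of R B A] subset_lower_rel[of R A] by auto
next
  show "R = lower_rel A (lower_transition R) \<and> lower_transition R ` A \<subseteq> B
      \<longrightarrow> R = upper_rel B (upper_transition R)
        \<and> upper_rel B (upper_transition R) = lower_rel A (lower_transition R)"
    \<comment> \<open>Now the upper relation is squeezed between \<open>R\<close> and the lower
      relation.\<close>
    using upper_rel_subset_lower_rel[of R A B] subset_upper_rel[of R B] by auto
qed

end
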